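(* Let $N\ge2$ be an integer and let $0=\xi_0<\xi_1<\dots<\xi_N=\pi$ be arbitrary. For every $F\in\mathcal C$ there is exactly one $G\in\mathcal X_N$ such that $$G\big(\xi_j,\tfrac{k\pi}N\big)=F\big(\xi_j,\tfrac{k\pi}N\big),\qquad j=0,\dots,N,\quad k=-N+1,\dots,N.$$
   Context: $\mathcal C$ is the set of functions $F:\mathbb R^2\to\mathbb C$ of the form $F=F^\circ\circ p$ with $F^\circ$ continuous on the unit sphere $\mathbb S^2$ and $p(\theta,\phi)=(\sin\theta\cos\phi,\sin\theta\sin\phi,\cos\theta)$. $\mathbb D_M^{\rm e}=\mathrm{span}\{\cos n\theta:0\le n\le M\}$ and $\mathbb D_M^{\rm o}=\mathrm{span}\{\sin\theta\cos n\theta:0\le n\le M\}$ (complex spans). $\mathcal X_N\subset\mathcal C$ is the set of all functions $(\theta,\phi)\mapsto\sum_{-N<m\le N}p_m(\theta)\exp(\mathrm i m\phi)$ with $p_m\in\mathbb D_N^{\rm e}$ for even $m$, $p_m(0)=p_m(\pi)=0$ for even $m\neq0$, and $p_m\in\mathbb D_{N-2}^{\rm o}$ for odd $m$. *)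

theory Defs
  imports "HOL-Analysis.Analysis" "HOL-Library.Function_Algebras"
begin

definition sph :: "real \<times> real \<Rightarrow> real ^ 3" where
  "sph = (\<lambda>(\<theta>, \<phi>). vector [sin \<theta> * cos \<phi>, sin \<theta> * sin \<phi>, cos \<theta>])"

definition sphere_funs :: "(real \<times> real \<Rightarrow> complex) set" where
  "sphere_funs = {Fo \<circ> sph |Fo. continuous_on (sphere 0 1) Fo}"

text \<open>Functions \<open>real \<Rightarrow> complex\<close> as a complex vector space; the library's \<open>span\<close> on its own
  is the real-linear span.\<close>

definition cfun_scale :: "complex \<Rightarrow> (real \<Rightarrow> complex) \<Rightarrow> real \<Rightarrow> complex" where
  "cfun_scale c f = (\<lambda>x. c * f x)"

global_interpretation cfun: vector_space cfun_scale
  by unfold_locales (auto simp: cfun_scale_def fun_eq_iff algebra_simps)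

definition D_even :: "nat \<Rightarrow> (real \<Rightarrow> complex) set" where
  "D_even M = cfun.span {\<lambda>\<theta>. of_real (cos (real n * \<theta>)) |n. n \<le> M}"

definition D_odd :: "nat \<Rightarrow> (real \<Rightarrow> complex) set" where
  "D_odd M = cfun.span {\<lambda>\<theta>. of_real (sin \<theta> * cos (real n * \<theta>)) |n. n \<le> M}"

text \<open>The condition \<open>2 \<le> N\<close> is needed for \<open>N - 2\<close>, a natural number, not to be truncated. That the
  members are indeed continuous functions on the sphere is lemma \<open>X_space_subset\<close> below.\<close>

definition X_space :: "nat \<Rightarrow> (real \<times> real \<Rightarrow> complex) set" where
  "X_space N = {(\<lambda>(\<theta>, \<phi>). \<Sum>m\<in>{- int N<..int N}. p m \<theta> * exp (\<i> * of_int m * of_real \<phi>)) |p.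
     \<forall>m\<in>{- int N<..int N}.
       (even m \<longrightarrow> p m \<in> D_even N) \<and>
       (even m \<and> m \<noteq> 0 \<longrightarrow> p m 0 = 0 \<and> p m pi = 0) \<and>
       (odd m \<longrightarrow> p m \<in> D_odd (N - 2))}"

lemma sum_fun_apply: "(\<Sum>a\<in>A. f a) x = (\<Sum>a\<in>A. f a x)"
  for f :: "'a \<Rightarrow> 'b \<Rightarrow> 'c::comm_monoid_add"
  by (induction A rule: infinite_finite_induct) auto

lemma cfun_span_family:
  fixes f :: "nat \<Rightarrow> real \<Rightarrow> complex"
  shows "cfun.span {f n |n. n \<le> M} = {\<lambda>x. \<Sum>n\<le>M. a n * f n x |a. True}" (is "?L = ?R")
proof
  have sub: "cfun.subspace ?R"
    unfolding cfun.subspace_def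
  proof (intro conjI ballI allI)
    show "0 \<in> ?R" by (auto intro!: exI[of _ "\<lambda>_. 0"])
  next
    fix g h assume "g \<in> ?R" "h \<in> ?R"
    then obtain a b where "g = (\<lambda>x. \<Sum>n\<le>M. a n * f n x)" "h = (\<lambda>x. \<Sum>n\<le>M. b n * f n x)"
      by auto
    then show "g + h \<in> ?R"
      by (auto intro!: exI[of _ "\<lambda>n. a n + b n"] simp: fun_eq_iff sum.distrib algebra_simps)
  next
    fix c g assume "g \<in> ?R"
    then obtain a where "g = (\<lambda>x. \<Sum>n\<le>M. a n * f n x)" by auto
    then show "cfun_scale c g \<in> ?R"
      by (auto intro!: exI[of _ "\<lambda>n. c * a n"] simp: fun_eq_iff cfun_scale_def sum_distrib_left
            algebra_simps)
  qed
  have "{f n |n. n \<le> M} \<subseteq> ?R"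
  proof clarify
    fix k assume "k \<le> M"
    then have "f k = (\<lambda>x. \<Sum>n\<le>M. (if n = k then 1 else 0) * f n x)"
      by (simp add: fun_eq_iff of_bool_def[symmetric])
    then show "\<exists>a. f k = (\<lambda>x. \<Sum>n\<le>M. a n * f n x) \<and> True"
      by (intro exI[of _ "\<lambda>n. if n = k then 1 else 0"]) simp
  qed
  then show "?L \<subseteq> ?R" using sub by (rule cfun.span_minimal)
next
  show "?R \<subseteq> ?L"
  proof clarify
    fix a :: "nat \<Rightarrow> complex"
    have "(\<lambda>x. \<Sum>n\<le>M. a n * f n x) = (\<Sum>n\<le>M. cfun_scale (a n) (f n))"
      by (simp add: fun_eq_iff sum_fun_apply cfun_scale_def)
    also have "\<dots> \<in> ?L"
      by (intro cfun.span_sum cfun.span_scale cfun.span_base) auto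
    finally show "(\<lambda>x. \<Sum>n\<le>M. a n * f n x) \<in> ?L" .
  qed
qed

lemma D_even_iff: "g \<in> D_even M \<longleftrightarrow> (\<exists>a. g = (\<lambda>\<theta>. \<Sum>n\<le>M. a n * of_real (cos (real n * \<theta>))))"
  unfolding D_even_def by (simp add: cfun_span_family[of "\<lambda>n \<theta>. of_real (cos (real n * \<theta>))"])

lemma D_odd_iff:
  "g \<in> D_odd M \<longleftrightarrow> (\<exists>a. g = (\<lambda>\<theta>. \<Sum>n\<le>M. a n * of_real (sin \<theta> * cos (real n * \<theta>))))"
  unfolding D_odd_def
  by (simp only: cfun_span_family[of "\<lambda>n \<theta>. of_real (sin \<theta> * cos (real n * \<theta>))"]) simp

lemma sph_eq_iff:
  "sph (\<theta>, \<phi>) = sph (\<theta>', \<phi>') \<longleftrightarrow> cos \<theta> = cos \<theta>' \<and>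
     of_real (sin \<theta>) * exp (\<i> * of_real \<phi>) = (of_real (sin \<theta>') * exp (\<i> * of_real \<phi>') :: complex)"
  by (auto simp: sph_def vec_eq_iff forall_3 complex_eq_iff Re_exp Im_exp)

lemma sph_in_sphere: "sph x \<in> sphere 0 1"
proof -
  obtain \<theta> \<phi> where x: "x = (\<theta>, \<phi>)" by force
  have "(sin \<theta> * cos \<phi>)\<^sup>2 + (sin \<theta> * sin \<phi>)\<^sup>2 + (cos \<theta>)\<^sup>2
      = (sin \<theta>)\<^sup>2 * ((cos \<phi>)\<^sup>2 + (sin \<phi>)\<^sup>2) + (cos \<theta>)\<^sup>2"
    by (simp only: power_mult_distrib distrib_left)
  also have "\<dots> = 1" by simp
  finally show ?thesis
    by (simp add: x sph_def norm_vec_def L2_set_def sum_3)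
qed

lemma continuous_on_sph: "continuous_on S sph"
proof -
  have "continuous_on S (\<lambda>x. \<chi> i. sph x $ i)"
  proof (rule continuous_on_vec_lambda)
    fix i :: 3
    show "continuous_on S (\<lambda>x. sph x $ i)"
      using exhaust_3[of i]
      by (elim disjE; simp add: sph_def case_prod_unfold; intro continuous_intros)
  qed
  then show ?thesis by simp
qed

lemma sph_image: "sph ` ({0..pi} \<times> {0..2*pi}) = sphere 0 1"
proof (intro equalityI subsetI)
  fix v :: "real ^ 3" assume "v \<in> sphere 0 1"
  then have v: "(v$1)\<^sup>2 + (v$2)\<^sup>2 + (v$3)\<^sup>2 = 1"
    by (simp add: norm_vec_def L2_set_def sum_3)
  define r where "r = sqrt ((v$1)\<^sup>2 + (v$2)\<^sup>2)"
  have r2: "r\<^sup>2 = (v$1)\<^sup>2 + (v$2)\<^sup>2" and r0: "0 \<le> r" by (auto simp: r_def)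
  obtain \<theta> where \<theta>: "0 \<le> \<theta>" "\<theta> \<le> pi" "v$3 = cos \<theta>" "r = sin \<theta>"
    using sincos_total_pi[OF r0, of "v$3"] v r2 by auto
  obtain \<phi> where \<phi>: "0 \<le> \<phi>" "\<phi> \<le> 2*pi" "v$1 = r * cos \<phi>" "v$2 = r * sin \<phi>"
  proof (cases "r = 0")
    case True
    then have "v$1 = 0" "v$2 = 0" using r2 by (auto simp: sum_power2_eq_zero_iff)
    then show ?thesis using that[of 0] True by auto
  next
    case False
    then have "(v$1 / r)\<^sup>2 + (v$2 / r)\<^sup>2 = 1"
      unfolding power_divide add_divide_distrib[symmetric] r2[symmetric] by simp
    from sincos_total_2pi_le[OF this] obtain t where
      "0 \<le> t" "t \<le> 2*pi" "v$1 / r = cos t" "v$2 / r = sin t" by auto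
    then show ?thesis using that[of t] False by (auto simp: field_simps)
  qed
  have "v = sph (\<theta>, \<phi>)"
    using \<theta> \<phi> by (simp add: sph_def vec_eq_iff forall_3)
  then show "v \<in> sph ` ({0..pi} \<times> {0..2*pi})" using \<theta> \<phi> by force
qed (use sph_in_sphere in auto)

lemma sphere_funsI:
  assumes G: "continuous_on UNIV G" and fib: "\<And>x y. sph x = sph y \<Longrightarrow> G x = G y"
  shows "G \<in> sphere_funs"
proof -
  define Fo where "Fo = (\<lambda>v. G (SOME x. sph x = v))"
  have comp: "Fo (sph x) = G x" for x
    unfolding Fo_def by (rule fib) (rule someI[of "\<lambda>y. sph y = sph x" x], rule refl)
  have "continuous_on (sphere 0 1) Fo"
    unfolding continuous_on_closed_vimage[OF closed_sphere]
  proof (intro allI impI)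
    fix B :: "complex set" assume B: "closed B"
    let ?K = "{0..pi} \<times> {0..2*pi}"
    have "Fo -` B \<inter> sphere 0 1 = sph ` (G -` B \<inter> ?K)"
      unfolding sph_image[symmetric] using comp by auto
    moreover have "compact (G -` B \<inter> ?K)"
      by (intro closed_Int_compact closed_vimage[OF B G] compact_Times compact_Icc)
    ultimately show "closed (Fo -` B \<inter> sphere 0 1)"
      by (simp add: compact_imp_closed compact_continuous_image continuous_on_sph)
  qed
  moreover have "G = Fo \<circ> sph" using comp by auto
  ultimately show ?thesis unfolding sphere_funs_def by blast
qed

lemma cos_mult_cong: "cos \<theta> = cos \<theta>' \<Longrightarrow> cos (real n * \<theta>) = cos (real n * \<theta>')"
proof -
  assume "cos \<theta> = cos \<theta>'"
  then obtain j where "j \<in> \<int>" and "\<theta> = \<theta>' + 2 * j * pi \<or> \<theta> = - \<theta>' + 2 * j * pi"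
    unfolding cos_eq by auto
  then obtain i :: int where i: "\<theta> = \<theta>' + 2 * i * pi \<or> \<theta> = - \<theta>' + 2 * i * pi"
    by (auto elim: Ints_cases)
  have per: "cos (x + 2 * pi * of_int k) = cos x" for x :: real and k :: int
    by (simp add: cos_add)
  from i show ?thesis
  proof
    assume "\<theta> = \<theta>' + 2 * i * pi"
    then have "real n * \<theta> = real n * \<theta>' + 2 * pi * of_int (int n * i)" by (simp add: algebra_simps)
    then show ?thesis by (simp only: per)
  next
    assume "\<theta> = - \<theta>' + 2 * i * pi"
    then have "real n * \<theta> = - (real n * \<theta>') + 2 * pi * of_int (int n * i)"
      by (simp only: distrib_left) simp
    then show ?thesis by (simp only: per cos_minus)
  qed
qed

lemma X_space_subset: "X_space N \<subseteq> sphere_funs"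
proof
  fix G assume "G \<in> X_space N"
  then obtain p where G: "G = (\<lambda>(\<theta>, \<phi>). \<Sum>m\<in>{- int N<..int N}. p m \<theta> * exp (\<i> * of_int m * of_real \<phi>))"
    and ev: "\<And>m. m \<in> {- int N<..int N} \<Longrightarrow> even m \<Longrightarrow> p m \<in> D_even N"
    and pole: "\<And>m. m \<in> {- int N<..int N} \<Longrightarrow> even m \<Longrightarrow> m \<noteq> 0 \<Longrightarrow> p m 0 = 0 \<and> p m pi = 0"
    and od: "\<And>m. m \<in> {- int N<..int N} \<Longrightarrow> odd m \<Longrightarrow> p m \<in> D_odd (N - 2)"
    unfolding X_space_def by blast
  have cont: "continuous_on UNIV (p m)" if "m \<in> {- int N<..int N}" for m
    using ev[OF that] od[OF that]
    by (cases "even m") (auto simp: D_even_iff D_odd_iff intro!: continuous_intros)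
  have cont2: "continuous_on UNIV (\<lambda>x::real\<times>real. p m (fst x))" if "m \<in> {- int N<..int N}" for m
    by (rule continuous_on_compose2[OF cont[OF that]]) (auto intro!: continuous_intros)
  show "G \<in> sphere_funs"
  proof (rule sphere_funsI)
    show "continuous_on UNIV G"
      unfolding G case_prod_unfold by (intro continuous_intros cont2)
  next
    fix x y assume xy: "sph x = sph y"
    obtain \<theta> \<phi> where x: "x = (\<theta>, \<phi>)" by force
    obtain \<theta>' \<phi>' where y: "y = (\<theta>', \<phi>')" by force
    define e e' :: complex where "e = exp (\<i> * of_real \<phi>)" and "e' = exp (\<i> * of_real \<phi>')"
    have c: "cos \<theta> = cos \<theta>'" and s: "of_real (sin \<theta>) * e = of_real (sin \<theta>') * e'"
      using xy by (auto simp: x y sph_eq_iff e_def e'_def)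
    have e0: "e \<noteq> 0" "e' \<noteq> 0" by (auto simp: e_def e'_def)
    have pw: "exp (\<i> * of_int m * of_real \<phi>) = e powi m" "exp (\<i> * of_int m * of_real \<phi>') = e' powi m"
      for m by (simp_all add: e_def e'_def exp_power_int mult_ac)
    have cc: "cos (real n * \<theta>) = cos (real n * \<theta>')" for n by (rule cos_mult_cong[OF c])
    have "(sin \<theta>)\<^sup>2 = (sin \<theta>')\<^sup>2" using c by (simp add: sin_squared_eq)
    then have ss: "sin \<theta>' = sin \<theta> \<or> sin \<theta>' = - sin \<theta>" by (auto simp: power2_eq_iff)
    have dich: "e' = e \<and> sin \<theta>' = sin \<theta> \<or> e' = - e \<and> sin \<theta>' = - sin \<theta>"
      if nz: "sin \<theta> \<noteq> 0"
    proof (cases "sin \<theta>' = sin \<theta>")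
      case False
      then have "sin \<theta>' = - sin \<theta>" using ss by simp
      moreover from this have "of_real (sin \<theta>) * e = of_real (sin \<theta>) * (- e')" using s by simp
      ultimately show ?thesis using nz by (simp only: mult_cancel_left of_real_eq_0_iff) simp
    qed (use s nz in auto)
    have "p m \<theta> * exp (\<i> * of_int m * of_real \<phi>) = p m \<theta>' * exp (\<i> * of_int m * of_real \<phi>')"
      if m: "m \<in> {- int N<..int N}" for m
    proof (cases "even m")
      case True
      then obtain a where a: "p m = (\<lambda>\<theta>. \<Sum>n\<le>N. a n * of_real (cos (real n * \<theta>)))"
        using ev[OF m] by (auto simp: D_even_iff)
      have pe: "p m \<alpha> = p m \<beta>" if "cos \<alpha> = cos \<beta>" for \<alpha> \<beta>
        unfolding a using cos_mult_cong[OF that] by simp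
      show ?thesis
      proof (cases "sin \<theta> = 0")
        case True
        then have "cos \<theta> = cos 0 \<or> cos \<theta> = cos pi"
          using sin_zero_abs_cos_one[of \<theta>] by (auto simp: abs_if split: if_splits)
        then have "m \<noteq> 0 \<Longrightarrow> p m \<theta> = 0"
          using pe[of \<theta> 0] pe[of \<theta> pi] pole[OF m \<open>even m\<close>] by auto
        then show ?thesis using pe[OF c] by (cases "m = 0") auto
      next
        case False
        then have "e' = e \<or> e' = - e" using dich by blast
        then have "e' powi m = e powi m" using \<open>even m\<close> by (auto simp: power_int_minus_left)
        then show ?thesis using pe[OF c] pw by simp
      qed
    next
      case False
      then obtain a where a: "p m = (\<lambda>\<theta>. \<Sum>n\<le>N-2. a n * of_real (sin \<theta> * cos (real n * \<theta>)))"
        using od[OF m] by (auto simp: D_odd_iff)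
      define q where "q = (\<Sum>n\<le>N-2. a n * of_real (cos (real n * \<theta>)))"
      have q: "p m \<theta> = of_real (sin \<theta>) * q" "p m \<theta>' = of_real (sin \<theta>') * q"
        unfolding a q_def cc by (simp_all add: sum_distrib_left mult_ac)
      show ?thesis
      proof (cases "sin \<theta> = 0")
        case True
        then show ?thesis using q ss by auto
      next
        case nz: False
        then have "e' = e \<and> sin \<theta>' = sin \<theta> \<or> e' = - e \<and> sin \<theta>' = - sin \<theta>" by (rule dich)
        then show ?thesis unfolding pw q using \<open>odd m\<close> by (auto simp: power_int_minus_left)
      qed
    qed
    then show "G x = G y" unfolding G x y by (auto intro!: sum.cong)
  qed
qed

end

theory Submission
  imports Defs
begin

text \<open>
  A function in the space is determined by its Fourier coefficients \<open>p\<^sub>m\<close> in \<open>\<phi>\<close>, and by discrete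
  Fourier inversion on the \<open>2N\<close> equispaced longitudes, interpolation on the grid means exactly that
  each \<open>p\<^sub>m\<close> takes prescribed values at \<open>\<xi>\<^sub>0, \<dots>, \<xi>\<^sub>N\<close>. For \<open>m \<noteq> 0\<close> the prescribed values at the
  poles are \<open>0\<close>, because \<open>F\<close> is constant there. For even \<open>m\<close> this is polynomial interpolation of
  degree \<open>N\<close> in \<open>cos \<theta>\<close> at \<open>N + 1\<close> nodes; for odd \<open>m\<close> the pole conditions are automatic and,
  after division by \<open>sin \<theta>\<close>, there remains interpolation of degree \<open>N - 2\<close> at the \<open>N - 1\<close> inner nodes.
\<close>

section \<open>Cosine polynomials as polynomials in \<open>cos \<theta>\<close>\<close>

text \<open>These are the Chebyshev polynomials of the first kind, built by their three-term
  recurrence. The nonzero coefficient makes the degree exactly \<open>n\<close>, so that they can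
  serve as a basis with one member in each degree.\<close>

lemma cos_multiple_eq_poly:
  "\<exists>T :: complex poly. degree T \<le> n \<and> coeff T n \<noteq> 0 \<and>
     (\<forall>\<theta>. of_real (cos (real n * \<theta>)) = poly T (of_real (cos \<theta>)))"
proof (induction n rule: induct_nat_012)
  case 0
  show ?case by (intro exI[of _ 1]) simp
next
  case 1
  show ?case by (intro exI[of _ "[:0, 1:]"]) simp
next
  case (ge2 n)
  then obtain S T :: "complex poly" where S: "degree S \<le> n"
      "\<And>\<theta>. of_real (cos (real n * \<theta>)) = poly S (of_real (cos \<theta>))"
    and T: "degree T \<le> Suc n" "coeff T (Suc n) \<noteq> 0"
      "\<And>\<theta>. of_real (cos (real (Suc n) * \<theta>)) = poly T (of_real (cos \<theta>))" by blast
  have rec: "cos (real (Suc (Suc n)) * \<theta>) = 2 * cos \<theta> * cos (real (Suc n) * \<theta>) - cos (real n * \<theta>)"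
    for \<theta>
    using cos_add[of "real (Suc n) * \<theta>" \<theta>] cos_diff[of "real (Suc n) * \<theta>" \<theta>]
    by (simp add: algebra_simps)
  have "degree ([:0, 2:] * T - S) \<le> Suc (Suc n)"
    using S(1) T(1) degree_mult_le[of "[:0, 2:]" T] by (intro degree_diff_le) auto
  moreover have "coeff ([:0, 2:] * T - S) (Suc (Suc n)) \<noteq> 0"
    using S(1) T(2) by (simp add: coeff_eq_0)
  moreover have "of_real (cos (real (Suc (Suc n)) * \<theta>)) = poly ([:0, 2:] * T - S) (of_real (cos \<theta>))"
    for \<theta>
    unfolding rec by (simp add: S(2)[symmetric] T(3)[symmetric] algebra_simps del: of_nat_Suc)
  ultimately show ?case by blast
qed

text \<open>The change of basis between the \<open>cos (n * \<theta>)\<close> and the powers of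
  \<open>cos \<theta>\<close> is triangular with nonzero diagonal, hence invertible.\<close>

lemma D_even_iff_poly:
  "g \<in> D_even M \<longleftrightarrow> (\<exists>P. degree P \<le> M \<and> g = (\<lambda>\<theta>. poly P (of_real (cos \<theta>))))"
proof -
  obtain T :: "nat \<Rightarrow> complex poly" where T: "\<And>n. degree (T n) \<le> n" "\<And>n. coeff (T n) n \<noteq> 0"
      "\<And>n \<theta>. of_real (cos (real n * \<theta>)) = poly (T n) (of_real (cos \<theta>))"
    using cos_multiple_eq_poly by metis
  \<comment> \<open>Here \<open>n\<close> is a strict bound on the indices of nonzero coefficients,
    so the induction starts from the zero polynomial and ends at \<open>Suc M\<close>.\<close>
  have poly_in: "(\<lambda>\<theta>. poly P (of_real (cos \<theta>))) \<in> D_even M"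
    if "\<forall>i\<ge>n. coeff P i = 0" "n \<le> Suc M" for n P
    using that
  proof (induction n arbitrary: P)
    case 0
    then have "(\<lambda>\<theta>. poly P (of_real (cos \<theta>))) = 0" by (simp add: fun_eq_iff poly_altdef)
    then show ?case unfolding D_even_def by (simp only: cfun.span_zero)
  next
    case (Suc n)
    \<comment> \<open>The multiple of \<open>T n\<close> is chosen to cancel the coefficient of
      index \<open>n\<close>.\<close>
    define Q where "Q = P - smult (coeff P n / coeff (T n) n) (T n)"
    have "coeff Q i = 0" if "i \<ge> n" for i
    proof (cases "i = n")
      case False
      then show ?thesis using that Suc.prems(1) le_less_trans[OF T(1)[of n], of i]
        by (simp add: Q_def coeff_eq_0)
    qed (simp add: Q_def T(2))
    then have "(\<lambda>\<theta>. poly Q (of_real (cos \<theta>))) \<in> D_even M" using Suc by simp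
    moreover have "(\<lambda>\<theta>. of_real (cos (real n * \<theta>))) \<in> D_even M"
      unfolding D_even_def using Suc.prems(2) by (intro cfun.span_base) auto
    ultimately have "(\<lambda>\<theta>. poly Q (of_real (cos \<theta>)))
        + cfun_scale (coeff P n / coeff (T n) n) (\<lambda>\<theta>. of_real (cos (real n * \<theta>))) \<in> D_even M"
      unfolding D_even_def by (intro cfun.span_add cfun.span_scale)
    then show ?case by (simp add: Q_def T(3) cfun_scale_def plus_fun_def)
  qed
  show ?thesis
  proof
    assume "g \<in> D_even M"
    then obtain a where g: "g = (\<lambda>\<theta>. \<Sum>n\<le>M. a n * of_real (cos (real n * \<theta>)))"
      by (auto simp: D_even_iff)
    have "degree (\<Sum>n\<le>M. smult (a n) (T n)) \<le> M"
      by (intro degree_sum_le) (auto intro!: order_trans[OF degree_smult_le] order_trans[OF T(1)])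
    moreover have "g = (\<lambda>\<theta>. poly (\<Sum>n\<le>M. smult (a n) (T n)) (of_real (cos \<theta>)))"
      by (simp add: g T(3) poly_sum)
    ultimately show "\<exists>P. degree P \<le> M \<and> g = (\<lambda>\<theta>. poly P (of_real (cos \<theta>)))" by blast
  next
    assume "\<exists>P. degree P \<le> M \<and> g = (\<lambda>\<theta>. poly P (of_real (cos \<theta>)))"
    then show "g \<in> D_even M" using poly_in[of "Suc M"] by (auto simp: coeff_eq_0)
  qed
qed

section \<open>Interpolation in \<open>\<theta>\<close>, one order \<open>m\<close> at a
  time\<close>

text \<open>Existence is Lagrange's formula, with \<open>L i\<close> the unnormalised basis
  polynomial; uniqueness holds because two solutions of degree at most \<open>M\<close> agree at
  \<open>M + 1\<close> distinct points.\<close>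

lemma lagrange_interpolation:
  fixes x y :: "'b \<Rightarrow> 'a::field"
  assumes A: "finite A" "card A = Suc M" and inj: "inj_on x A"
  shows "\<exists>!P. degree P \<le> M \<and> (\<forall>i\<in>A. poly P (x i) = y i)"
proof -
  define L where "L i = (\<Prod>j\<in>A - {i}. [:- x j, 1:])" for i
  define P where "P = (\<Sum>i\<in>A. smult (y i / poly (L i) (x i)) (L i))"
  have degL: "degree (L i) \<le> M" if "i \<in> A" for i
  proof -
    have "degree (L i) \<le> (\<Sum>j\<in>A - {i}. degree [:- x j, 1:])"
      unfolding L_def using A(1) by (intro degree_prod_sum_le[unfolded comp_def]) auto
    then show ?thesis using A that by simp
  qed
  have L_nz: "poly (L i) (x i) \<noteq> 0" if "i \<in> A" for i
    using A(1) that inj by (auto simp: L_def poly_prod inj_on_def)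
  have L_0: "poly (L j) (x i) = 0" if "i \<in> A" "j \<in> A" "i \<noteq> j" for i j
    using A(1) that by (auto simp: L_def poly_prod)
  have P: "degree P \<le> M"
    unfolding P_def by (intro degree_sum_le A(1) order_trans[OF degree_smult_le] degL)
  have P_eq: "poly P (x i) = y i" if i: "i \<in> A" for i
  proof -
    have "poly P (x i) = (\<Sum>j\<in>A. if j = i then y i else 0)"
      unfolding P_def poly_sum using i by (intro sum.cong) (auto simp: L_nz L_0)
    then show ?thesis using A(1) i by simp
  qed
  show ?thesis
  proof (intro ex1I[of _ P] conjI ballI P P_eq)
    fix Q assume Q: "degree Q \<le> M \<and> (\<forall>i\<in>A. poly Q (x i) = y i)"
    then show "Q = P"
      using P P_eq A inj by (intro poly_eqI_degree[of "x ` A"]) (auto simp: card_image)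
  qed
qed

lemma D_odd_iff_poly:
  "g \<in> D_odd M \<longleftrightarrow>
     (\<exists>P. degree P \<le> M \<and> g = (\<lambda>\<theta>. of_real (sin \<theta>) * poly P (of_real (cos \<theta>))))"
proof -
  have "(\<lambda>\<theta>. \<Sum>n\<le>M. a n * of_real (sin \<theta> * cos (real n * \<theta>)))
      = (\<lambda>\<theta>. of_real (sin \<theta>) * (\<Sum>n\<le>M. a n * of_real (cos (real n * \<theta>))))" for a :: "nat \<Rightarrow> complex"
    by (simp add: sum_distrib_left mult_ac)
  then have "g \<in> D_odd M \<longleftrightarrow> (\<exists>h\<in>D_even M. g = (\<lambda>\<theta>. of_real (sin \<theta>) * h \<theta>))"
    unfolding D_odd_iff Bex_def D_even_iff by auto
  then show ?thesis unfolding Bex_def D_even_iff_poly by blast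
qed

text \<open>Dividing the data by the weight reduces this to Lagrange interpolation at the nodes
  \<open>cos (x i)\<close>. The weight 1 serves even orders, the weight \<open>sin\<close> odd
  ones.\<close>

lemma weighted_cos_interpolation:
  fixes w :: "real \<Rightarrow> real" and y :: "'b \<Rightarrow> complex"
  assumes "finite A" "card A = Suc M" and inj: "inj_on (\<lambda>i. cos (x i)) A"
    and w: "\<And>i. i \<in> A \<Longrightarrow> w (x i) \<noteq> 0"
  shows "\<exists>!g. (\<exists>P. degree P \<le> M \<and> g = (\<lambda>\<theta>. of_real (w \<theta>) * poly P (of_real (cos \<theta>)))) \<and>
    (\<forall>i\<in>A. g (x i) = y i)"
proof -
  have "inj_on (\<lambda>i. of_real (cos (x i)) :: complex) A"
    using inj by (simp add: inj_on_def)
  from lagrange_interpolation[OF assms(1,2) this, of "\<lambda>i. y i / of_real (w (x i))"]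
  obtain P where P: "degree P \<le> M" "\<forall>i\<in>A. poly P (of_real (cos (x i))) = y i / of_real (w (x i))"
    and uniq: "\<And>Q. degree Q \<le> M \<Longrightarrow>
      \<forall>i\<in>A. poly Q (of_real (cos (x i))) = y i / of_real (w (x i)) \<Longrightarrow> Q = P"
    by blast
  show ?thesis
  proof (rule ex1I[of _ "\<lambda>\<theta>. of_real (w \<theta>) * poly P (of_real (cos \<theta>))"])
    show "(\<exists>Q. degree Q \<le> M \<and> (\<lambda>\<theta>. of_real (w \<theta>) * poly P (of_real (cos \<theta>)))
          = (\<lambda>\<theta>. of_real (w \<theta>) * poly Q (of_real (cos \<theta>)))) \<and>
        (\<forall>i\<in>A. of_real (w (x i)) * poly P (of_real (cos (x i))) = y i)"
      using P w by auto
  next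
    fix g
    assume g: "(\<exists>Q. degree Q \<le> M \<and> g = (\<lambda>\<theta>. of_real (w \<theta>) * poly Q (of_real (cos \<theta>)))) \<and>
      (\<forall>i\<in>A. g (x i) = y i)"
    then obtain Q where Q: "degree Q \<le> M" "g = (\<lambda>\<theta>. of_real (w \<theta>) * poly Q (of_real (cos \<theta>)))"
      by blast
    have "Q = P" using Q(1) by (rule uniq) (use g w in \<open>simp add: Q(2) field_simps\<close>)
    with Q(2) show "g = (\<lambda>\<theta>. of_real (w \<theta>) * poly P (of_real (cos \<theta>)))" by simp
  qed
qed

text \<open>Isolates the constraint in \<open>X_space\<close> on a single coefficient, so that
  existence and uniqueness can be settled for each \<open>m\<close> separately.\<close>

definition X_coeff :: "nat \<Rightarrow> int \<Rightarrow> (real \<Rightarrow> complex) \<Rightarrow> bool" where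
  "X_coeff N m g \<longleftrightarrow> (even m \<longrightarrow> g \<in> D_even N) \<and> (even m \<and> m \<noteq> 0 \<longrightarrow> g 0 = 0 \<and> g pi = 0) \<and>
     (odd m \<longrightarrow> g \<in> D_odd (N - 2))"

lemma X_coeff_interpolation:
  fixes \<xi> :: "nat \<Rightarrow> real"
  assumes N: "N \<ge> 2" and \<xi>: "\<xi> 0 = 0" "\<xi> N = pi" and inc: "\<And>j. j < N \<Longrightarrow> \<xi> j < \<xi> (Suc j)"
    and y: "m \<noteq> 0 \<Longrightarrow> y 0 = 0 \<and> y N = 0"
  shows "\<exists>!g. X_coeff N m g \<and> (\<forall>j\<in>{0..N}. g (\<xi> j) = y j)"
proof -
  have less: "\<xi> i < \<xi> j" if "i < j" "j \<le> N" for i j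
    using that(1,2)
  proof (induction rule: strict_inc_induct)
    case (base i)
    then show ?case using inc[of i] by simp
  next
    case (step i)
    then show ?case using inc[of i] by fastforce
  qed
  have le: "\<xi> i \<le> \<xi> j" if "i \<le> j" "j \<le> N" for i j
    using less[of i j] that by (cases "i = j") simp_all
  have rng: "0 \<le> \<xi> j" "\<xi> j \<le> pi" if "j \<le> N" for j
    using le[of 0 j] le[of j N] \<xi> that by simp_all
  \<comment> \<open>The nodes lie in \<open>[0, pi]\<close>, where \<open>cos\<close> is
    injective.\<close>
  have inj: "inj_on (\<lambda>j. cos (\<xi> j)) {0..N}"
  proof (rule inj_onI)
    fix i j assume ij: "i \<in> {0..N}" "j \<in> {0..N}" "cos (\<xi> i) = cos (\<xi> j)"
    then have "\<xi> i = \<xi> j" using rng by (auto intro: cos_inj_pi[of "\<xi> i" "\<xi> j"])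
    then show "i = j" using less[of i j] less[of j i] ij by (cases i j rule: linorder_cases) auto
  qed
  show ?thesis
  proof (cases "even m")
    case True
    \<comment> \<open>The poles are themselves nodes, and for nonzero \<open>m\<close> the data
      vanish there, so interpolation already enforces the pole conditions.\<close>
    have "X_coeff N m g \<and> (\<forall>j\<in>{0..N}. g (\<xi> j) = y j) \<longleftrightarrow> g \<in> D_even N \<and> (\<forall>j\<in>{0..N}. g (\<xi> j) = y j)" for g
    proof -
      have "g (\<xi> 0) = y 0 \<and> g (\<xi> N) = y N" if "\<forall>j\<in>{0..N}. g (\<xi> j) = y j" using that by simp
      then show ?thesis unfolding X_coeff_def using True \<xi> y by auto
    qed
    then show ?thesis
      using weighted_cos_interpolation[OF _ _ inj, of N "\<lambda>_. 1" y] by (simp add: D_even_iff_poly)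
  next
    case False
    then have "m \<noteq> 0" by auto
    have split: "{0..N} = {0, N} \<union> {1..<N}" using N by auto
    \<comment> \<open>The factor \<open>sin\<close> vanishes at both poles, as do the data.\<close>
    have "g (\<xi> 0) = y 0 \<and> g (\<xi> N) = y N" if "g \<in> D_odd (N - 2)" for g
      using that y[OF \<open>m \<noteq> 0\<close>] \<xi> by (auto simp: D_odd_iff)
    then have "X_coeff N m g \<and> (\<forall>j\<in>{0..N}. g (\<xi> j) = y j)
        \<longleftrightarrow> g \<in> D_odd (N - 2) \<and> (\<forall>j\<in>{1..<N}. g (\<xi> j) = y j)" for g
      unfolding X_coeff_def split using False by auto
    \<comment> \<open>The inner nodes number \<open>N - 1 = Suc (N - 2)\<close>, which fits the
      degree \<open>N - 2\<close>.\<close>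
    moreover have "\<exists>!g. g \<in> D_odd (N - 2) \<and> (\<forall>j\<in>{1..<N}. g (\<xi> j) = y j)"
      unfolding D_odd_iff_poly
    proof (rule weighted_cos_interpolation)
      show "inj_on (\<lambda>j. cos (\<xi> j)) {1..<N}" by (rule inj_on_subset[OF inj]) auto
      fix j assume "j \<in> {1..<N}"
      then show "sin (\<xi> j) \<noteq> 0"
        using less[of 0 j] less[of j N] \<xi> by (intro less_imp_neq[symmetric] sin_gt_zero) auto
    qed (use N in auto)
    ultimately show ?thesis by simp
  qed
qed

section \<open>Discrete Fourier inversion on the longitudes\<close>

text \<open>For nonzero \<open>d\<close> this is a sum of powers of a root of unity \<open>z\<close>
  over a full period. Multiplication by \<open>z\<close> only shifts the range, so the sum is fixed
  by it and vanishes since \<open>z \<noteq> 1\<close>.\<close>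

lemma sum_root_of_unity:
  assumes N: "N > 0" and d: "\<bar>d\<bar> < 2 * int N"
  shows "(\<Sum>k\<in>{- int N<..int N}. exp (\<i> * of_int d * of_real (of_int k * pi / real N)))
       = (if d = 0 then 2 * of_nat N else 0)"
proof (cases "d = 0")
  case False
  define z where "z = exp (\<i> * of_real (of_int d * pi / real N))"
  have z0: "z \<noteq> 0" by (simp add: z_def)
  have pw: "exp (\<i> * of_int d * of_real (of_int k * pi / real N)) = z powi k" for k
    by (simp add: z_def exp_power_int mult_ac)
  \<comment> \<open>Otherwise \<open>d\<close> would be a nonzero multiple of
    \<open>2 * N\<close>.\<close>
  have "z \<noteq> 1"
  proof
    assume "z = 1"
    then obtain n :: int where "of_int d * pi / real N = of_int (2 * n) * pi"
      by (auto simp: z_def exp_eq_1)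
    then have "of_int d = (of_int (2 * n) * of_int (int N) :: real)"
      using N by (simp add: field_simps)
    then have "d = 2 * n * int N" by (simp only: of_int_eq_iff flip: of_int_mult)
    moreover from this have "n \<noteq> 0" using False by auto
    ultimately have "\<bar>d\<bar> \<ge> 2 * int N"
      using mult_right_mono[of 1 "\<bar>n\<bar>" "int N"] by (simp add: abs_mult)
    then show False using d by simp
  qed
  have "z powi (int N * 2) = exp (2 * of_int d * of_real pi * \<i>)"
    using N by (simp add: pw[symmetric] field_simps)
  also have "\<dots> = 1" by (auto simp: exp_eq_1 mult_ac intro!: exI[of _ d])
  \<comment> \<open>The term that enters under the shift equals the one that leaves: their exponents
    differ by the period \<open>2 * N\<close>.\<close>
  finally have per: "z powi (int N + 1) = z powi (- int N + 1)"
    using power_int_add[of z "- int N + 1" "int N * 2"] z0 by (simp add: add.commute)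
  let ?S = "\<Sum>k\<in>{- int N<..int N}. z powi k"
  have "z * ?S = (\<Sum>k\<in>{- int N<..int N}. z powi (k + 1))"
    using z0 by (simp add: sum_distrib_left power_int_add mult.commute)
  also have "\<dots> = (\<Sum>k\<in>{- int N + 1<..int N + 1}. z powi k)"
    by (rule sum.reindex_bij_witness[of _ "\<lambda>k. k - 1" "\<lambda>k. k + 1"]) auto
  also have "\<dots> = ?S"
  proof -
    have "{- int N + 1<..int N + 1} = insert (int N + 1) {- int N + 1<..int N}"
      "{- int N<..int N} = insert (- int N + 1) {- int N + 1<..int N}"
      using N by auto
    then show ?thesis using per by simp
  qed
  finally have "(z - 1) * ?S = 0" by (simp add: algebra_simps)
  then show ?thesis unfolding pw using \<open>z \<noteq> 1\<close> False by simp
qed simp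

text \<open>Both directions come from the orthogonality \<open>orth\<close>. Frequencies and grid
  indices share the set \<open>I\<close> and \<open>e\<close> is symmetric, so the same relation
  also sums over frequencies.\<close>

lemma discrete_fourier_inversion:
  fixes c f :: "int \<Rightarrow> complex"
  assumes N: "N > 0"
  defines "I \<equiv> {- int N<..int N}"
    and "e \<equiv> (\<lambda>m k. exp (\<i> * of_int m * of_real (of_int k * pi / real N)))"
  shows "(\<forall>k\<in>I. (\<Sum>m\<in>I. c m * e m k) = f k)
     \<longleftrightarrow> (\<forall>m\<in>I. c m = (\<Sum>k\<in>I. f k * e (- m) k) / (2 * of_nat N))" (is "?L \<longleftrightarrow> ?R")
proof -
  have fin: "finite I" by (simp add: I_def)
  have add: "e m k * e n k = e (m + n) k" for m n k
    by (simp add: e_def ring_distribs add_divide_distrib flip: exp_add)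
  have sym: "e m k = e k m" for m k by (simp add: e_def mult_ac)
  have neg: "e (- m) k = e m (- k)" for m k by (simp add: e_def)
  \<comment> \<open>Exchanges the roles of frequency and grid index, to make \<open>orth\<close>
    applicable to a sum over \<open>m\<close>.\<close>
  have swap: "e (- m) l * e m k = e k m * e (- l) m" for k l m
    using neg[of m l] sym[of "- l" m] sym[of m k] by (simp add: mult.commute)
  have root: "(\<Sum>k\<in>I. e d k) = (if d = 0 then 2 * of_nat N else 0)" if "\<bar>d\<bar> < 2 * int N" for d
    unfolding e_def I_def by (rule sum_root_of_unity[OF N that])
  have orth: "(\<Sum>k\<in>I. e m k * e (- n) k) = (if m = n then 2 * of_nat N else 0)"
    if "m \<in> I" "n \<in> I" for m n
  proof -
    have "\<bar>m - n\<bar> < 2 * int N" using that by (simp add: I_def abs_less_iff)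
    from root[OF this] show ?thesis by (simp add: add)
  qed
  have inv: "(\<Sum>k\<in>I. (\<Sum>m\<in>I. a m * e m k) * e (- n) k) = 2 * of_nat N * a n" if "n \<in> I" for a n
  proof -
    have "(\<Sum>k\<in>I. (\<Sum>m\<in>I. a m * e m k) * e (- n) k) = (\<Sum>m\<in>I. a m * (\<Sum>k\<in>I. e m k * e (- n) k))"
      by (simp only: sum_distrib_right sum_distrib_left mult.assoc) (rule sum.swap)
    also have "\<dots> = (\<Sum>m\<in>I. if m = n then 2 * of_nat N * a n else 0)"
      using that by (intro sum.cong) (auto simp: orth)
    finally show ?thesis using that fin by simp
  qed
  show ?thesis
  proof
    assume L: ?L
    show ?R
    proof
      fix n assume n: "n \<in> I"
      have "(\<Sum>k\<in>I. f k * e (- n) k) = 2 * of_nat N * c n"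
        using L inv[OF n, of c] by (simp cong: sum.cong)
      then show "c n = (\<Sum>k\<in>I. f k * e (- n) k) / (2 * of_nat N)" using N by simp
    qed
  next
    assume R: ?R
    show ?L
    proof
      fix k assume k: "k \<in> I"
      have "(\<Sum>m\<in>I. c m * e m k) = (\<Sum>m\<in>I. (\<Sum>l\<in>I. f l * e (- m) l) * e m k) / (2 * of_nat N)"
        by (subst sum_divide_distrib) (use R in \<open>auto intro!: sum.cong\<close>)
      also have "(\<Sum>m\<in>I. (\<Sum>l\<in>I. f l * e (- m) l) * e m k)
          = (\<Sum>m\<in>I. \<Sum>l\<in>I. f l * (e (- m) l * e m k))"
        by (simp only: sum_distrib_right mult.assoc)
      also have "\<dots> = (\<Sum>l\<in>I. \<Sum>m\<in>I. f l * (e k m * e (- l) m))"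
        by (subst sum.swap) (simp add: swap)
      also have "\<dots> = (\<Sum>l\<in>I. f l * (if k = l then 2 * of_nat N else 0))"
        using k by (intro sum.cong) (auto simp: orth simp flip: sum_distrib_left)
      also have "\<dots> = (\<Sum>l\<in>I. if l = k then f k * (2 * of_nat N) else 0)"
        by (intro sum.cong) auto
      also have "\<dots> = f k * (2 * of_nat N)"
        using fin k by simp
      finally show "(\<Sum>m\<in>I. c m * e m k) = f k" using N by simp
    qed
  qed
qed

section \<open>Assembling the interpolant from its Fourier coefficients\<close>

text \<open>All that is used of the data is that they are constant in \<open>k\<close> on the two
  polar rows. Fourier inversion along each row decouples the orders \<open>m\<close>.\<close>

lemma grid_interpolation:
  fixes N :: nat and \<xi> :: "nat \<Rightarrow> real" and f :: "nat \<Rightarrow> int \<Rightarrow> complex"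
  assumes "N \<ge> 2"
    and "\<xi> 0 = 0" and "\<xi> N = pi" and "\<And>j. j < N \<Longrightarrow> \<xi> j < \<xi> (Suc j)"
    and f_pole: "\<And>k. f 0 k = f 0 0" "\<And>k. f N k = f N 0"
  shows "\<exists>!G. G \<in> X_space N \<and>
    (\<forall>j\<in>{0..N}. \<forall>k\<in>{- int N + 1..int N}. G (\<xi> j, of_int k * pi / real N) = f j k)"
proof -
  define I where "I = {- int N<..int N}"
  have I': "{- int N + 1..int N} = I" by (auto simp: I_def)
  have N: "N > 0" using assms(1) by simp
  define e where "e = (\<lambda>m k. exp (\<i> * of_int m * of_real (of_int k * pi / real N)))"
  \<comment> \<open>The discrete Fourier coefficient of order \<open>m\<close> of row
    \<open>j\<close>: the value that \<open>p m\<close> must take at \<open>\<xi> j\<close>.\<close>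
  define y where "y m j = (\<Sum>k\<in>I. f j k * e (- m) k) / (2 * of_nat N)" for m j
  define G where "G p = (\<lambda>(\<theta>, \<phi>). \<Sum>m\<in>I. p m \<theta> * exp (\<i> * of_int m * of_real \<phi>))"
    for p :: "int \<Rightarrow> real \<Rightarrow> complex"
  have dft: "(\<forall>k\<in>I. (\<Sum>m\<in>I. c m * e m k) = h k)
      \<longleftrightarrow> (\<forall>m\<in>I. c m = (\<Sum>k\<in>I. h k * e (- m) k) / (2 * of_nat N))" for c h
    unfolding I_def e_def by (rule discrete_fourier_inversion[OF N])
  have X: "X_space N = {G p |p. \<forall>m\<in>I. X_coeff N m (p m)}"
    unfolding X_space_def X_coeff_def G_def I_def by (rule refl)
  have interp: "(\<forall>j\<in>{0..N}. \<forall>k\<in>I. G p (\<xi> j, of_int k * pi / real N) = f j k)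
      \<longleftrightarrow> (\<forall>m\<in>I. \<forall>j\<in>{0..N}. p m (\<xi> j) = y m j)" for p
    using dft[of "\<lambda>m. p m (\<xi> j)" "f j" for j]
    unfolding G_def y_def e_def[symmetric] by (auto simp: e_def)
  have pole: "y m j = 0" if "m \<in> I" "m \<noteq> 0" "\<And>k. f j k = f j 0" for m j
  proof -
    \<comment> \<open>A constant row is synthesised from order 0 alone, so \<open>dft\<close> forces
      its other coefficients to be 0.\<close>
    have "(\<Sum>m\<in>I. (if m = 0 then a else 0) * e m k) = a" for a k
      using N by (simp add: if_distrib[of "\<lambda>x. x * _"] I_def e_def cong: if_cong)
    then have "\<forall>k\<in>I. (\<Sum>m\<in>I. (if m = 0 then f j 0 else 0) * e m k) = f j k"
      using that(3) by metis
    from dft[THEN iffD1, OF this] show ?thesis using that(1,2) by (auto simp: y_def)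
  qed
  have ex1: "\<exists>!g. X_coeff N m g \<and> (\<forall>j\<in>{0..N}. g (\<xi> j) = y m j)" if "m \<in> I" for m
    using pole[OF that _ f_pole(1)] pole[OF that _ f_pole(2)]
    by (intro X_coeff_interpolation assms(1-4)) auto
  then obtain p where p: "\<And>m. m \<in> I \<Longrightarrow> X_coeff N m (p m) \<and> (\<forall>j\<in>{0..N}. p m (\<xi> j) = y m j)"
    by metis
  show ?thesis unfolding I'
  proof (rule ex1I[of _ "G p"])
    show "G p \<in> X_space N \<and> (\<forall>j\<in>{0..N}. \<forall>k\<in>I. G p (\<xi> j, of_int k * pi / real N) = f j k)"
      unfolding interp X using p by blast
  next
    fix H assume H: "H \<in> X_space N \<and> (\<forall>j\<in>{0..N}. \<forall>k\<in>I. H (\<xi> j, of_int k * pi / real N) = f j k)"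
    then obtain q where q: "H = G q" "\<And>m. m \<in> I \<Longrightarrow> X_coeff N m (q m)" unfolding X by blast
    have "\<forall>m\<in>I. \<forall>j\<in>{0..N}. q m (\<xi> j) = y m j" using H unfolding q(1) interp by (rule conjunct2)
    \<comment> \<open>Agreement on \<open>I\<close> suffices, as \<open>G\<close> reads only the
      coefficients with index in \<open>I\<close>.\<close>
    then have "q m = p m" if "m \<in> I" for m
      using ex1[OF that] p[OF that] q(2)[OF that] that by blast
    then show "H = G p" unfolding q(1) G_def by (auto intro!: sum.cong)
  qed
qed

text \<open>At a pole all longitudes give the same point of the sphere; this supplies the constancy
  on the polar rows.\<close>

lemma sphere_funs_pole:
  assumes "F \<in> sphere_funs" "sin \<theta> = 0"
  shows "F (\<theta>, \<phi>) = F (\<theta>, \<phi>')"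
proof -
  have "sph (\<theta>, \<phi>) = sph (\<theta>, \<phi>')" using assms(2) by (simp add: sph_eq_iff)
  then show ?thesis using assms(1) by (auto simp: sphere_funs_def)
qed

theorem proposition2p1:
  fixes N :: nat and \<xi> :: "nat \<Rightarrow> real" and F :: "real \<times> real \<Rightarrow> complex"
  assumes "N \<ge> 2"
    and "\<xi> 0 = 0" and "\<xi> N = pi" and "\<And>j. j < N \<Longrightarrow> \<xi> j < \<xi> (Suc j)"
    and "F \<in> sphere_funs"
  shows "\<exists>!G. G \<in> X_space N \<and>
    (\<forall>j\<in>{0..N}. \<forall>k\<in>{- int N + 1..int N}.
       G (\<xi> j, of_int k * pi / real N) = F (\<xi> j, of_int k * pi / real N))"
  using assms(1-4) by (rule grid_interpolation) (auto intro!: sphere_funs_pole[OF assms(5)] simp: assms(2,3))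

end
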